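(* Let $\sigma$ be a spectral function. (1) Suppose that $\sigma\in L^q$ for some $1\le q<\infty$, and let $p$ be the conjugate exponent, $\frac1p+\frac1q=1$. Then $L_\sigma$ is strictly larger than $L^p$: $L^p\subsetneqq L_\sigma$. (2) In particular (case $q=1$), $L_\sigma$ is always strictly larger than $L^\infty$: $L^\infty\subsetneqq L_\sigma$.
   Context: Let $(\Omega,\mathcal{F},P)$ be an atomless probability space and $L^0$ the space of real-valued random variables, identified when almost surely equal; $L^p=L^p(\Omega,\mathcal{F},P)$. A spectral function is a nondecreasing function $\sigma:[0,1)\to[0,\infty)$ with $\int_0^1\sigma(u)\,du=1$; $\sigma\in L^q$ refers to Lebesgue measure on $[0,1)$. For a random variable $Y$ and $0<u<1$ let $F_Y^{-1}(u):=\inf\{y:P(Y\le y)\ge u\}$, and let $\rho_\sigma(Y):=\int_0^1\sigma(u)F_Y^{-1}(u)\,du$ when the integral exists. Put $\|Y\|_\sigma:=\rho_\sigma(|Y|)\in[0,\infty]$ for $Y\in L^0$ and $L_\sigma:=\{Y\in L^0:\|Y\|_\sigma<\infty\}$. *)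

theory Defs
  imports "HOL-Probability.Probability"
begin

definition atomless :: "'a measure \<Rightarrow> bool" where
  "atomless M \<longleftrightarrow>
     (\<forall>A\<in>sets M. 0 < emeasure M A \<longrightarrow>
        (\<exists>B\<in>sets M. B \<subseteq> A \<and> 0 < emeasure M B \<and> emeasure M B < emeasure M A))"

definition ae_eq :: "'a measure \<Rightarrow> (('a \<Rightarrow> real) \<times> ('a \<Rightarrow> real)) set" where
  "ae_eq M = {(X, Y). X \<in> borel_measurable M \<and> Y \<in> borel_measurable M \<and>
                      (AE \<omega> in M. X \<omega> = Y \<omega>)}"

lemma equiv_ae_eq: "equiv (borel_measurable M) (ae_eq M)"
proof (rule equivI)
  show "ae_eq M \<subseteq> borel_measurable M \<times> borel_measurable M"
    by (auto simp: ae_eq_def)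
  show "refl_on (borel_measurable M) (ae_eq M)"
    by (auto simp: ae_eq_def refl_on_def)
  show "sym (ae_eq M)"
    by (auto simp: ae_eq_def sym_def eq_commute)
  show "trans (ae_eq M)"
  proof (rule transI)
    fix X Y Z assume "(X, Y) \<in> ae_eq M" "(Y, Z) \<in> ae_eq M"
    then have "AE \<omega> in M. X \<omega> = Y \<omega>" "AE \<omega> in M. Y \<omega> = Z \<omega>"
      and "X \<in> borel_measurable M" "Z \<in> borel_measurable M"
      by (auto simp: ae_eq_def)
    moreover from this(1,2) have "AE \<omega> in M. X \<omega> = Z \<omega>" by eventually_elim simp
    ultimately show "(X, Z) \<in> ae_eq M" by (simp add: ae_eq_def)
  qed
qed

text \<open>Spaces of random variables come in two layers: a set of measurable functions, saturated
  for almost sure equality, and its quotient, the set of equivalence classes.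
  Exponents live in \<^typ>\<open>ennreal\<close>, so that \<open>p = \<infinity>\<close> is allowed; they are only used for \<open>p \<ge> 1\<close>.\<close>

definition Lp_fun :: "'a measure \<Rightarrow> ennreal \<Rightarrow> ('a \<Rightarrow> real) set" where
  "Lp_fun M p =
     (if p = \<infinity> then {Y \<in> borel_measurable M. \<exists>C. AE \<omega> in M. \<bar>Y \<omega>\<bar> \<le> C}
      else {Y \<in> borel_measurable M. integrable M (\<lambda>\<omega>. \<bar>Y \<omega>\<bar> powr enn2real p)})"

definition Lp :: "'a measure \<Rightarrow> ennreal \<Rightarrow> ('a \<Rightarrow> real) set set" where
  "Lp M p = Lp_fun M p // ae_eq M"

text \<open>A function on \<open>[0,1)\<close> is represented by a total function whose values elsewhere are
  irrelevant.\<close>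

definition spectral_function :: "(real \<Rightarrow> real) \<Rightarrow> bool" where
  "spectral_function \<sigma> \<longleftrightarrow>
     mono_on {0..<1} \<sigma> \<and> (\<forall>u\<in>{0..<1}. 0 \<le> \<sigma> u) \<and>
     set_integrable lborel {0..<1} \<sigma> \<and> (LBINT u:{0..<1}. \<sigma> u) = 1"

definition quantile :: "'a measure \<Rightarrow> ('a \<Rightarrow> real) \<Rightarrow> real \<Rightarrow> real" where
  "quantile M Y u = Inf {y. \<P>(\<omega> in M. Y \<omega> \<le> y) \<ge> u}"

text \<open>The extended Lebesgue integral, as the difference of the integrals of the positive and the
  negative part. It is meaningful unless both are infinite.\<close>

definition spectral_risk :: "'a measure \<Rightarrow> (real \<Rightarrow> real) \<Rightarrow> ('a \<Rightarrow> real) \<Rightarrow> ereal" where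
  "spectral_risk M \<sigma> Y =
     enn2ereal (\<integral>\<^sup>+u\<in>{0<..<1}. ennreal (\<sigma> u * quantile M Y u) \<partial>lborel) -
     enn2ereal (\<integral>\<^sup>+u\<in>{0<..<1}. ennreal (- (\<sigma> u * quantile M Y u)) \<partial>lborel)"

definition spectral_norm :: "'a measure \<Rightarrow> (real \<Rightarrow> real) \<Rightarrow> ('a \<Rightarrow> real) \<Rightarrow> ereal" where
  "spectral_norm M \<sigma> Y = spectral_risk M \<sigma> (\<lambda>\<omega>. \<bar>Y \<omega>\<bar>)"

definition L_spectral_fun :: "'a measure \<Rightarrow> (real \<Rightarrow> real) \<Rightarrow> ('a \<Rightarrow> real) set" where
  "L_spectral_fun M \<sigma> = {Y \<in> borel_measurable M. spectral_norm M \<sigma> Y < \<infinity>}"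

definition L_spectral :: "'a measure \<Rightarrow> (real \<Rightarrow> real) \<Rightarrow> ('a \<Rightarrow> real) set set" where
  "L_spectral M \<sigma> = L_spectral_fun M \<sigma> // ae_eq M"

lemma Lp_fun_ae_eq:
  assumes "(X, Y) \<in> ae_eq M"
  shows "X \<in> Lp_fun M p \<longleftrightarrow> Y \<in> Lp_fun M p"
proof -
  have [measurable]: "X \<in> borel_measurable M" "Y \<in> borel_measurable M"
    and ae: "AE \<omega> in M. X \<omega> = Y \<omega>"
    using assms by (auto simp: ae_eq_def)
  have "(AE \<omega> in M. \<bar>X \<omega>\<bar> \<le> C) \<longleftrightarrow> (AE \<omega> in M. \<bar>Y \<omega>\<bar> \<le> C)" for C
    using ae by (intro eventually_subst) (auto elim!: eventually_mono)
  moreover have "integrable M (\<lambda>\<omega>. \<bar>X \<omega>\<bar> powr enn2real p) \<longleftrightarrow>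
      integrable M (\<lambda>\<omega>. \<bar>Y \<omega>\<bar> powr enn2real p)"
    using ae by (intro integrable_cong_AE) (auto elim!: eventually_mono)
  ultimately show ?thesis by (simp add: Lp_fun_def)
qed

lemma quantile_ae_eq:
  assumes "(X, Y) \<in> ae_eq M"
  shows "quantile M X u = quantile M Y u"
proof -
  have [measurable]: "X \<in> borel_measurable M" "Y \<in> borel_measurable M"
    and ae: "AE \<omega> in M. X \<omega> = Y \<omega>"
    using assms by (auto simp: ae_eq_def)
  have "\<P>(\<omega> in M. X \<omega> \<le> y) = \<P>(\<omega> in M. Y \<omega> \<le> y)" for y
    using ae by (intro measure_eq_AE) (auto elim!: eventually_mono)
  then show ?thesis by (simp add: quantile_def)
qed

lemma spectral_norm_ae_eq:
  assumes "(X, Y) \<in> ae_eq M"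
  shows "spectral_norm M \<sigma> X = spectral_norm M \<sigma> Y"
proof -
  have "((\<lambda>\<omega>. \<bar>X \<omega>\<bar>), (\<lambda>\<omega>. \<bar>Y \<omega>\<bar>)) \<in> ae_eq M"
    using assms by (auto simp: ae_eq_def elim!: eventually_mono)
  from quantile_ae_eq[OF this] show ?thesis
    by (simp add: spectral_norm_def spectral_risk_def)
qed

lemma (in prob_space) quantile_nonneg:
  assumes [measurable]: "Y \<in> borel_measurable M" and nn: "\<And>\<omega>. 0 \<le> Y \<omega>" and u: "0 < u" "u < 1"
  shows "0 \<le> quantile M Y u"
proof -
  interpret D: real_distribution "distr M borel Y" by simp
  have cdf: "cdf (distr M borel Y) y = \<P>(\<omega> in M. Y \<omega> \<le> y)" for y
    by (auto simp: cdf_def measure_distr vimage_def Int_def conj_commute intro!: arg_cong[where f=prob])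
  have "eventually (\<lambda>y. u < cdf (distr M borel Y) y) at_top"
    using D.cdf_lim_at_top_prob u by (intro order_tendstoD) auto
  then obtain y where "u < cdf (distr M borel Y) y"
    using eventually_happens'[OF trivial_limit_at_top_linorder] by blast
  then have "y \<in> {y. \<P>(\<omega> in M. Y \<omega> \<le> y) \<ge> u}" by (simp add: cdf)
  moreover have "0 \<le> z" if "z \<in> {y. \<P>(\<omega> in M. Y \<omega> \<le> y) \<ge> u}" for z
  proof (rule ccontr)
    assume "\<not> 0 \<le> z"
    then have "{\<omega> \<in> space M. Y \<omega> \<le> z} = {}" using nn by (auto simp: not_le) (meson le_less_trans not_le order_trans)
    with that u show False by simp
  qed
  ultimately show ?thesis unfolding quantile_def by (intro cInf_greatest) auto
qed

lemma (in prob_space) spectral_norm_eq_nn_integral: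
  assumes "spectral_function \<sigma>" "Y \<in> borel_measurable M"
  shows "spectral_norm M \<sigma> Y =
    enn2ereal (\<integral>\<^sup>+u\<in>{0<..<1}. ennreal (\<sigma> u * quantile M (\<lambda>\<omega>. \<bar>Y \<omega>\<bar>) u) \<partial>lborel)"
proof -
  have "0 \<le> \<sigma> u * quantile M (\<lambda>\<omega>. \<bar>Y \<omega>\<bar>) u" if "u \<in> {0<..<1}" for u
    using assms that by (intro mult_nonneg_nonneg quantile_nonneg) (auto simp: spectral_function_def)
  then have "(\<integral>\<^sup>+u\<in>{0<..<1}. ennreal (- (\<sigma> u * quantile M (\<lambda>\<omega>. \<bar>Y \<omega>\<bar>) u)) \<partial>lborel)
      = (\<integral>\<^sup>+(u::real). 0 \<partial>lborel)"
    by (intro nn_integral_cong) (auto simp: indicator_def ennreal_neg)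
  then show ?thesis by (simp add: spectral_norm_def spectral_risk_def zero_ennreal.rep_eq)
qed

end

theory Submission
  imports Defs
begin

text \<open>
  Write \<open>g\<close> for the quantile function of \<open>\<bar>Y\<bar>\<close>, so that the norm of \<open>Y\<close> is the integral of \<open>\<sigma> g\<close> over
  \<open>(0,1)\<close>.

  The inclusion is the inequality of Young: for \<open>1 < q\<close> one has \<open>\<sigma> g \<le> \<sigma>\<^sup>q + g\<^sup>p\<close>, and under Lebesgue measure
  on \<open>(0,1)\<close> the function \<open>g\<close> has the same law as \<open>\<bar>Y\<bar>\<close>, so the integral of \<open>g\<^sup>p\<close> is the \<open>p\<close>-th
  moment of \<open>\<bar>Y\<bar>\<close>. For \<open>q = 1\<close> the function \<open>g\<close> is bounded and \<open>\<sigma>\<close> is integrable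
  (\<open>Lp_finite_quantile_integral\<close>).

  Strictness rests on a gain in the estimate of Hoelder. The integral \<open>S(\<epsilon>)\<close> of \<open>\<sigma>\<close> over \<open>(1-\<epsilon>,1)\<close> is at most
  \<open>\<epsilon>\<close> to the power \<open>1/p\<close>, times the \<open>L\<^sup>q\<close> norm of \<open>\<sigma>\<close> on that interval; the last factor tends to \<open>0\<close>, so
  \<open>S(\<epsilon>)\<close> is of smaller order than \<open>\<epsilon>\<close> to the power \<open>1/p = 1 - 1/q\<close>
  (\<open>eventually_tail_integral_le_powr\<close>). An atomless space contains a decreasing sequence of events
  \<open>A\<^sub>n\<close> of positive probabilities \<open>\<epsilon>\<^sub>n\<close> so small that \<open>S(\<epsilon>\<^sub>n)\<close> is at most \<open>4\<close> to the power \<open>-n\<close> times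
  \<open>\<epsilon>\<^sub>n\<close> to the power \<open>1/p\<close> (\<open>atomless_decreasing_events\<close>). Put \<open>Y = \<Sum>n. c\<^sub>n 1(A\<^sub>n)\<close>, where \<open>c\<^sub>n\<close> is
  \<open>2\<close> to the power \<open>n\<close> times \<open>\<epsilon>\<^sub>n\<close> to the power \<open>-1/p\<close>. The quantile function of \<open>Y\<close> is at most the sum
  of the functions \<open>c\<^sub>n 1(1-\<epsilon>\<^sub>n,1)\<close> (\<open>quantile_tower_le\<close>), hence the norm of \<open>Y\<close> is at most
  \<open>\<Sum>n. c\<^sub>n S(\<epsilon>\<^sub>n)\<close>, which is dominated by a geometric series. On the other hand \<open>Y \<ge> c\<^sub>n\<close> on \<open>A\<^sub>n\<close>
  forces the \<open>L\<^sup>p\<close> norm of \<open>Y\<close> to be at least \<open>2\<close> to the power \<open>n\<close>, for every \<open>n\<close>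
  (\<open>not_in_Lp_of_large_peaks\<close>). With the exponent written as \<open>1 - 1/q\<close> this covers \<open>q = 1\<close>,
  \<open>p = \<infinity>\<close> as well, and the second assertion is this case because \<open>\<sigma>\<close> is integrable by definition.
\<close>

section \<open>Small events in an atomless space\<close>

text \<open>If an event splits into two of positive probability, one of them has at most half the
  probability of the whole; repeated halving gets below any positive bound.\<close>

lemma (in prob_space) atomless_small_subset:
  assumes "atomless M" and A: "A \<in> sets M" "0 < prob A" and "0 < d"
  shows "\<exists>B\<in>sets M. B \<subseteq> A \<and> 0 < prob B \<and> prob B < d"
proof -
  have half: "\<exists>C\<in>sets M. C \<subseteq> B \<and> 0 < prob C \<and> prob C \<le> prob B / 2"
    if B: "B \<in> sets M" "0 < prob B" for B
  proof -
    obtain C where C: "C \<in> sets M" "C \<subseteq> B" "0 < prob C" "prob C < prob B"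
      using \<open>atomless M\<close> B unfolding atomless_def
      by (metis emeasure_eq_measure ennreal_less_iff ennreal_0 measure_nonneg order_refl)
    have "prob (B - C) = prob B - prob C"
      using B C by (intro finite_measure_Diff) auto
    with C B show ?thesis
      by (cases "prob C \<le> prob B / 2") (auto intro: bexI[of _ C] bexI[of _ "B - C"])
  qed
  have "\<exists>B\<in>sets M. B \<subseteq> A \<and> 0 < prob B \<and> prob B \<le> prob A / 2 ^ n" for n
  proof (induction n)
    case 0
    then show ?case using A by auto
  next
    case (Suc n)
    then obtain B where B: "B \<in> sets M" "B \<subseteq> A" "0 < prob B" "prob B \<le> prob A / 2 ^ n"
      by blast
    obtain C where "C \<in> sets M" "C \<subseteq> B" "0 < prob C" "prob C \<le> prob B / 2"
      using half B by blast
    with B show ?case by (intro bexI[of _ C]) auto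
  qed
  moreover obtain n where "prob A / d < 2 ^ n"
    using real_arch_pow[of 2 "prob A / d"] by auto
  ultimately show ?thesis
    using \<open>0 < d\<close> by (smt (verit) divide_less_eq mult.commute zero_less_power)
qed

text \<open>A requirement that holds for all sufficiently small numbers can be imposed on the probabilities
  of the chosen events, by taking at each stage a subevent that is small enough.\<close>

lemma (in prob_space) atomless_decreasing_events:
  assumes "atomless M" and Q: "\<And>n. eventually (Q n) (at_right 0)"
  obtains A :: "nat \<Rightarrow> 'a set"
  where "\<And>n. A n \<in> sets M" "decseq A" "\<And>n. 0 < prob (A n)" "\<And>n. Q n (prob (A n))"
    "(\<lambda>n. prob (A n)) \<longlonglongrightarrow> 0"
proof -
  have ex: "\<exists>B. (B \<in> sets M \<and> 0 < prob B \<and> prob B < inverse (real (Suc n)) \<and> Q n (prob B)) \<and> B \<subseteq> A"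
    if A: "A \<in> sets M" "0 < prob A" for A n
  proof -
    obtain b where b: "0 < b" "\<And>y. 0 < y \<Longrightarrow> y < b \<Longrightarrow> Q n y"
      using Q[of n] unfolding eventually_at_right_field by blast
    obtain B where "B \<in> sets M" "B \<subseteq> A" "0 < prob B" "prob B < min b (inverse (real (Suc n)))"
      using atomless_small_subset[OF assms(1) A, of "min b (inverse (real (Suc n)))"] b(1)
      by auto
    with b(2)[of "prob B"] show ?thesis by auto
  qed
  define P where
    "P n B \<longleftrightarrow> B \<in> sets M \<and> 0 < prob B \<and> prob B < inverse (real (Suc n)) \<and> Q n (prob B)" for n B
  have "\<exists>A. \<forall>n. P n (A n) \<and> A (Suc n) \<subseteq> A n"
  proof (rule dependent_nat_choice)
    show "\<exists>B. P 0 B"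
      using ex[of "space M" 0] by (auto simp: P_def prob_space)
    show "\<exists>B. P (Suc n) B \<and> B \<subseteq> A" if "P n A" for A n
      using ex[of A "Suc n"] that by (auto simp: P_def)
  qed
  then obtain A where A: "\<And>n. P n (A n)" "\<And>n. A (Suc n) \<subseteq> A n" by blast
  have "(\<lambda>n. prob (A n)) \<longlonglongrightarrow> 0"
    using A(1) by (intro tendsto_sandwich[OF _ _ tendsto_const LIMSEQ_inverse_real_of_nat])
      (auto simp: P_def intro!: always_eventually less_imp_le)
  with A show ?thesis by (intro that[of A]) (auto simp: P_def intro: decseq_SucI)
qed

section \<open>Tail integrals\<close>

lemma eventually_small_tail_integral:
  fixes f :: "real \<Rightarrow> ennreal"
  assumes [measurable]: "f \<in> borel_measurable borel" and fin: "(\<integral>\<^sup>+u. f u \<partial>lborel) < \<infinity>"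
    and "0 < \<eta>"
  shows "eventually (\<lambda>\<epsilon>. (\<integral>\<^sup>+u\<in>{1-\<epsilon><..<1}. f u \<partial>lborel) \<le> \<eta>) (at_right 0)"
proof -
  define g where "g n u = f u * indicator {1 - inverse (real (Suc n))<..<1} u" for n u
  have [measurable]: "g n \<in> borel_measurable borel" for n
    unfolding g_def by measurable
  have "(\<integral>\<^sup>+u. (INF n. g n u) \<partial>lborel) = (INF n. \<integral>\<^sup>+u. g n u \<partial>lborel)"
  proof (rule nn_integral_monotone_convergence_INF_AE')
    show "AE u in lborel. g (Suc n) u \<le> g n u" for n
    proof -
      have "{1 - inverse (real (Suc (Suc n)))<..<1} \<subseteq> {1 - inverse (real (Suc n))<..<1}"
        by (auto elim!: le_less_trans[rotated] intro: le_imp_inverse_le)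
      then show ?thesis
        unfolding g_def by (intro AE_I2 mult_left_mono) (auto simp: indicator_def)
    qed
    have "(\<integral>\<^sup>+u. g 0 u \<partial>lborel) \<le> (\<integral>\<^sup>+u. f u \<partial>lborel)"
      by (intro nn_integral_mono) (auto simp: g_def indicator_def)
    with fin show "(\<integral>\<^sup>+u. g 0 u \<partial>lborel) < \<infinity>" by simp
  qed simp
  moreover have "(INF n. g n u) = 0" for u
  proof -
    obtain n where "g n u = 0"
    proof (cases "u < 1")
      case True
      then obtain n where "inverse (real (Suc n)) < 1 - u"
        using reals_Archimedean[of "1 - u"] by auto
      then show ?thesis by (intro that[of n]) (auto simp: g_def indicator_def)
    qed (use that[of 0] in \<open>auto simp: g_def\<close>)
    then show ?thesis by (metis INF_lower UNIV_I le_zero_eq)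
  qed
  ultimately have "(INF n. \<integral>\<^sup>+u. g n u \<partial>lborel) < \<eta>" using \<open>0 < \<eta>\<close> by simp
  then obtain n where n: "(\<integral>\<^sup>+u. g n u \<partial>lborel) < \<eta>" by (auto simp: INF_less_iff)
  have "(\<integral>\<^sup>+u\<in>{1-\<epsilon><..<1}. f u \<partial>lborel) \<le> \<eta>" if "\<epsilon> < inverse (real (Suc n))" for \<epsilon>
  proof -
    have "(\<integral>\<^sup>+u\<in>{1-\<epsilon><..<1}. f u \<partial>lborel) \<le> (\<integral>\<^sup>+u. g n u \<partial>lborel)"
      using that by (intro nn_integral_mono) (auto simp: g_def indicator_def)
    with n show ?thesis by simp
  qed
  then show ?thesis
    unfolding eventually_at_right_field by (intro exI[of _ "inverse (real (Suc n))"]) auto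
qed

text \<open>A linearised form of the inequality of Young with a free threshold \<open>K\<close>: above \<open>K\<close> the ratio \<open>x / K\<close>
  is at most its \<open>q\<close>-th power. It holds for \<open>q = 1\<close> too, where there is no finite conjugate exponent.\<close>

lemma le_add_powr:
  fixes x K q :: real
  assumes "0 \<le> x" "0 < K" "1 \<le> q"
  shows "x \<le> K + K powr (1 - q) * x powr q"
proof (cases "x \<le> K")
  case False
  then have "(x / K) powr (q - 1) \<ge> 1" using assms by (intro ge_one_powr_ge_zero) auto
  then have "x \<le> x * (x / K) powr (q - 1)" using assms by (simp add: mult_le_cancel_left1)
  also have "\<dots> = K powr (1 - q) * x powr q"
    using assms False
    by (simp add: powr_divide powr_diff field_simps)
  finally show ?thesis using assms by simp
qed (use assms in \<open>simp add: add_increasing2\<close>)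

text \<open>Integrating \<open>s \<le> K + K powr (1 - q) * s powr q\<close> over \<open>(1-\<epsilon>,1)\<close> bounds the tail by
  \<open>K * \<epsilon> + K powr (1 - q) * T\<close>, where \<open>T\<close> is the tail integral of \<open>s powr q\<close> and tends to \<open>0\<close>.\<close>

lemma eventually_tail_integral_le_powr:
  fixes s :: "real \<Rightarrow> real"
  assumes [measurable]: "s \<in> borel_measurable borel" and s: "\<And>u. 0 \<le> s u" and q: "1 \<le> q"
    and fin: "(\<integral>\<^sup>+u. ennreal (s u powr q) \<partial>lborel) < \<infinity>" and \<eta>: "0 < \<eta>"
  shows "eventually (\<lambda>\<epsilon>. (\<integral>\<^sup>+u\<in>{1-\<epsilon><..<1}. ennreal (s u) \<partial>lborel)
           \<le> ennreal (\<eta> * \<epsilon> powr (1 - 1 / q))) (at_right 0)"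
proof -
  have "eventually (\<lambda>\<epsilon>. (\<integral>\<^sup>+u\<in>{1-\<epsilon><..<1}. ennreal (s u powr q) \<partial>lborel)
      \<le> ennreal ((\<eta> / 2) powr q)) (at_right 0)"
    using fin \<eta> by (intro eventually_small_tail_integral) auto
  moreover have "eventually (\<lambda>\<epsilon>::real. 0 < \<epsilon>) (at_right 0)"
    by (rule eventually_at_right_less)
  ultimately show ?thesis
  proof eventually_elim
    case (elim \<epsilon>)
    (* This threshold gives both terms the order \<epsilon> powr (1 - 1 / q). *)
    define K where "K = \<eta> / 2 * \<epsilon> powr (- 1 / q)"
    have K: "0 < K" using elim \<eta> by (simp add: K_def)
    have lin: "K * \<epsilon> = \<eta> / 2 * \<epsilon> powr (1 - 1 / q)"
      using elim by (simp add: K_def powr_diff powr_minus field_simps)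
    have "K powr (1 - q) = (\<eta> / 2) powr (1 - q) * \<epsilon> powr (- 1 / q * (1 - q))"
      unfolding K_def using elim \<eta> by (subst powr_mult) (auto simp: powr_powr)
    also have "- 1 / q * (1 - q) = 1 - 1 / q" using q by (simp add: field_simps)
    finally have pow: "K powr (1 - q) * (\<eta> / 2) powr q = \<eta> / 2 * \<epsilon> powr (1 - 1 / q)"
      using \<eta> by (simp add: powr_diff field_simps)
    have "(\<integral>\<^sup>+u\<in>{1-\<epsilon><..<1}. ennreal (s u) \<partial>lborel)
        \<le> (\<integral>\<^sup>+u. ennreal K * indicator {1-\<epsilon><..<1} u +
             ennreal (K powr (1 - q)) * (ennreal (s u powr q) * indicator {1-\<epsilon><..<1} u) \<partial>lborel)"
      using le_add_powr[OF s K q] K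
      by (intro nn_integral_mono)
        (auto simp: indicator_def ennreal_plus[symmetric] ennreal_mult[symmetric] simp del: ennreal_plus intro!: ennreal_leI)
    also have "\<dots> = ennreal K * ennreal \<epsilon> + ennreal (K powr (1 - q)) *
        (\<integral>\<^sup>+u\<in>{1-\<epsilon><..<1}. ennreal (s u powr q) \<partial>lborel)"
      using elim by (simp add: nn_integral_add nn_integral_cmult)
    also have "\<dots> \<le> ennreal K * ennreal \<epsilon> + ennreal (K powr (1 - q)) * ennreal ((\<eta> / 2) powr q)"
      using elim by (intro add_left_mono mult_left_mono) auto
    also have "\<dots> = ennreal (K * \<epsilon>) + ennreal (K powr (1 - q) * (\<eta> / 2) powr q)"
      using K elim by (simp add: ennreal_mult)
    also have "\<dots> = ennreal (\<eta> * \<epsilon> powr (1 - 1 / q))"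
      unfolding lin pow using \<eta> by (subst ennreal_plus[symmetric]) (auto simp del: ennreal_plus)
    finally show ?case .
  qed
qed

section \<open>Quantiles\<close>

text \<open>The distribution function is right continuous, so the infimum in the definition of the quantile
  is attained.\<close>

lemma (in prob_space) quantile_le_iff:
  assumes [measurable]: "Y \<in> borel_measurable M" and u: "0 < u" "u < 1"
  shows "quantile M Y u \<le> y \<longleftrightarrow> u \<le> \<P>(\<omega> in M. Y \<omega> \<le> y)"
proof -
  interpret D: cdf_distribution "distr M borel Y"
    by (simp add: cdf_distribution_def)
  have "cdf (distr M borel Y) y = \<P>(\<omega> in M. Y \<omega> \<le> y)" for y
    by (auto simp: cdf_def measure_distr vimage_def Int_def conj_commute intro!: arg_cong[where f=prob])
  with D.pseudoinverse[OF u, of y] show ?thesis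
    by (simp add: quantile_def)
qed

text \<open>The quantile function, as a random variable on \<open>(0,1)\<close>, has the law of \<open>Y\<close>: it is the
  pseudoinverse of the distribution function.\<close>

lemma (in prob_space)
  assumes [measurable]: "Y \<in> borel_measurable M"
  shows quantile_measurable:
      "quantile M Y \<in> borel_measurable (restrict_space lborel {0<..<1})"
    and distr_quantile:
      "distr (restrict_space lborel {0<..<1}) borel (quantile M Y) = distr M borel Y"
proof -
  interpret D: cdf_distribution "distr M borel Y"
    by (simp add: cdf_distribution_def)
  have "cdf (distr M borel Y) y = \<P>(\<omega> in M. Y \<omega> \<le> y)" for y
    by (auto simp: cdf_def measure_distr vimage_def Int_def conj_commute intro!: arg_cong[where f=prob])
  then have I: "D.I = quantile M Y"
    by (simp add: fun_eq_iff quantile_def)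
  show "quantile M Y \<in> borel_measurable (restrict_space lborel {0<..<1})"
    using D.measurable_CI unfolding I
    by (simp add: measurable_def space_restrict_space sets_restrict_space)
  show "distr (restrict_space lborel {0<..<1}) borel (quantile M Y) = distr M borel Y"
    using D.distr_I_eq_M unfolding I .
qed

lemma (in prob_space) nn_integral_quantile:
  fixes f :: "real \<Rightarrow> ennreal"
  assumes [measurable]: "Y \<in> borel_measurable M" "f \<in> borel_measurable borel"
  shows "(\<integral>\<^sup>+u\<in>{0<..<1}. f (quantile M Y u) \<partial>lborel) = (\<integral>\<^sup>+\<omega>. f (Y \<omega>) \<partial>M)"
proof -
  note [measurable] = quantile_measurable[OF assms(1)]
  have "(\<integral>\<^sup>+u\<in>{0<..<1}. f (quantile M Y u) \<partial>lborel)
      = (\<integral>\<^sup>+u. f (quantile M Y u) \<partial>restrict_space lborel {0<..<1})"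
    by (simp add: nn_integral_restrict_space)
  also have "\<dots> = (\<integral>\<^sup>+y. f y \<partial>distr (restrict_space lborel {0<..<1}) borel (quantile M Y))"
    by (simp add: nn_integral_distr)
  also have "\<dots> = (\<integral>\<^sup>+\<omega>. f (Y \<omega>) \<partial>M)"
    by (simp add: distr_quantile nn_integral_distr)
  finally show ?thesis .
qed

section \<open>An unbounded function on a decreasing sequence of events\<close>

text \<open>Off the null set \<open>\<Inter>n. A n\<close> the sum is finite: outside \<open>A n\<close> only the terms before the \<open>n\<close>-th survive.
  The same remark bounds the quantiles. For \<open>u \<le> 1 - prob (A n)\<close> the complement of \<open>A n\<close> has
  probability at least \<open>u\<close>, so the quantile at \<open>u\<close> is at most the sum of \<open>c k\<close> over \<open>k < n\<close>. On the
  null set the series may diverge and its value is arbitrary.\<close>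

lemma (in prob_space) tower_function:
  fixes c :: "nat \<Rightarrow> real"
  assumes A[measurable]: "\<And>n. A n \<in> sets M" and "decseq A"
    and lim: "(\<lambda>n. prob (A n)) \<longlonglongrightarrow> 0" and c: "\<And>n. 0 \<le> c n"
  defines "Y \<equiv> \<lambda>\<omega>. \<Sum>n. c n * indicator (A n) \<omega>"
  shows tower_measurable: "Y \<in> borel_measurable M"
    and tower_ge: "AE \<omega> in M. \<omega> \<in> A n \<longrightarrow> c n \<le> Y \<omega>"
    and quantile_tower_le: "0 < u \<Longrightarrow> u < 1 \<Longrightarrow>
      ennreal (quantile M (\<lambda>\<omega>. \<bar>Y \<omega>\<bar>) u)
        \<le> (\<Sum>n. ennreal (c n) * indicator {1 - prob (A n)<..<1} u)"
proof -
  show Y[measurable]: "Y \<in> borel_measurable M" unfolding Y_def by measurable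
  have notin: "\<omega> \<notin> A m" if "\<omega> \<notin> A n" "n \<le> m" for \<omega> m n
    using decseqD[OF \<open>decseq A\<close> that(2)] that(1) by auto
  have Y_eq: "Y \<omega> = (\<Sum>k<n. c k * indicator (A k) \<omega>)" if "\<omega> \<notin> A n" for \<omega> n
    unfolding Y_def using notin[OF that] by (intro suminf_finite) (auto simp: not_less)
  have "prob (\<Inter>n. A n) = 0"
    using finite_Lim_measure_decseq[of A] \<open>decseq A\<close> lim LIMSEQ_unique by (auto simp: image_subset_iff)
  then have null: "AE \<omega> in M. \<omega> \<notin> (\<Inter>n. A n)"
    by (intro AE_not_in) (auto simp: null_sets_def emeasure_eq_measure)
  show "AE \<omega> in M. \<omega> \<in> A n \<longrightarrow> c n \<le> Y \<omega>"
    using null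
  proof eventually_elim
    case (elim \<omega>)
    then obtain m where m: "\<omega> \<notin> A m" by auto
    show ?case
    proof
      assume "\<omega> \<in> A n"
      with m notin have "n < m" using linorder_not_le by blast
      then have "(\<Sum>k\<in>{n}. c k * indicator (A k) \<omega>) \<le> (\<Sum>k<m. c k * indicator (A k) \<omega>)"
        using c by (intro sum_mono2) auto
      with \<open>\<omega> \<in> A n\<close> show "c n \<le> Y \<omega>" by (simp add: Y_eq[OF m])
    qed
  qed
  assume u: "0 < u" "u < 1"
  have "eventually (\<lambda>n. prob (A n) < 1 - u) sequentially"
    using lim u by (intro order_tendstoD) auto
  then obtain n0 where "prob (A n0) < 1 - u"
    by (auto simp: eventually_sequentially)
  then have ex: "\<exists>n. u \<le> 1 - prob (A n)" by (intro exI[of _ n0]) simp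
  (* For the least such n, every k < n has 1 - prob (A k) < u and is counted on the right-hand side. *)
  define N where "N = (LEAST n. u \<le> 1 - prob (A n))"
  have N: "u \<le> 1 - prob (A N)" unfolding N_def using ex by (rule LeastI_ex)
  have less: "1 - prob (A k) < u" if "k < N" for k
    using not_less_Least[of k "\<lambda>n. u \<le> 1 - prob (A n)"] that by (simp add: N_def)
  have "u \<le> prob (space M - A N)" using N by (simp add: prob_compl)
  also have "\<dots> \<le> \<P>(\<omega> in M. \<bar>Y \<omega>\<bar> \<le> (\<Sum>k<N. c k))"
  proof (intro finite_measure_mono)
    show "space M - A N \<subseteq> {\<omega> \<in> space M. \<bar>Y \<omega>\<bar> \<le> (\<Sum>k<N. c k)}"
    proof (intro subsetI CollectI conjI)
      fix \<omega> assume \<omega>: "\<omega> \<in> space M - A N"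
      then have "Y \<omega> = (\<Sum>k<N. c k * indicator (A k) \<omega>)" by (intro Y_eq) auto
      moreover have "\<dots> \<le> (\<Sum>k<N. c k)" using c by (intro sum_mono) (auto simp: indicator_def)
      moreover have "0 \<le> (\<Sum>k<N. c k * indicator (A k) \<omega>)" using c by (intro sum_nonneg) auto
      ultimately show "\<bar>Y \<omega>\<bar> \<le> (\<Sum>k<N. c k)" by simp
    qed auto
  qed measurable
  finally have "quantile M (\<lambda>\<omega>. \<bar>Y \<omega>\<bar>) u \<le> (\<Sum>k<N. c k)"
    using u by (subst quantile_le_iff) auto
  then have "ennreal (quantile M (\<lambda>\<omega>. \<bar>Y \<omega>\<bar>) u) \<le> ennreal (\<Sum>k<N. c k)" by (rule ennreal_leI)
  also have "\<dots> = (\<Sum>k<N. ennreal (c k) * indicator {1 - prob (A k)<..<1} u)"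
    using less u c by (simp flip: sum_ennreal)
  also have "\<dots> \<le> (\<Sum>n. ennreal (c n) * indicator {1 - prob (A n)<..<1} u)"
    by (rule sum_le_suminf) auto
  finally show "ennreal (quantile M (\<lambda>\<omega>. \<bar>Y \<omega>\<bar>) u)
      \<le> (\<Sum>n. ennreal (c n) * indicator {1 - prob (A n)<..<1} u)" .
qed

text \<open>The function that separates the two spaces. Its peaks are recorded without reference to \<open>p\<close>;
  the factor \<open>2 ^ n\<close> is what rules out \<open>L\<^sup>p\<close>, since \<open>1 / q - 1 = - 1 / p\<close>.\<close>

lemma (in prob_space) exists_finite_norm_large_peaks:
  fixes s :: "real \<Rightarrow> real"
  assumes "atomless M"
    and [measurable]: "s \<in> borel_measurable borel" and s: "\<And>u. 0 \<le> s u" and q: "1 \<le> q"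
    and fin: "(\<integral>\<^sup>+u. ennreal (s u powr q) \<partial>lborel) < \<infinity>"
  obtains Y where "Y \<in> borel_measurable M"
    "(\<integral>\<^sup>+u\<in>{0<..<1}. ennreal (s u * quantile M (\<lambda>\<omega>. \<bar>Y \<omega>\<bar>) u) \<partial>lborel) < \<infinity>"
    "\<And>n. \<exists>A\<in>sets M. 0 < prob A \<and>
       (AE \<omega> in M. \<omega> \<in> A \<longrightarrow> 2 ^ n * prob A powr (1 / q - 1) \<le> Y \<omega>)"
proof -
  define Q where "Q n \<epsilon> \<longleftrightarrow> (\<integral>\<^sup>+u\<in>{1-\<epsilon><..<1}. ennreal (s u) \<partial>lborel)
      \<le> ennreal ((1 / 4) ^ n * \<epsilon> powr (1 - 1 / q))" for n :: nat and \<epsilon>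
  have "eventually (Q n) (at_right 0)" for n
    unfolding Q_def using s q fin by (intro eventually_tail_integral_le_powr) auto
  then obtain A where A[measurable]: "\<And>n. A n \<in> sets M" and dec: "decseq A"
    and pos: "\<And>n. 0 < prob (A n)" and Q: "\<And>n. Q n (prob (A n))"
    and lim: "(\<lambda>n. prob (A n)) \<longlonglongrightarrow> 0"
    using atomless_decreasing_events[OF \<open>atomless M\<close>] by metis
  define c where "c n = 2 ^ n * prob (A n) powr (1 / q - 1)" for n
  have c: "0 \<le> c n" for n by (simp add: c_def)
  define Y where "Y \<omega> = (\<Sum>n. c n * indicator (A n) \<omega>)" for \<omega>
  note tower = tower_measurable[OF A dec lim c] tower_ge[OF A dec lim c]
    quantile_tower_le[OF A dec lim c]
  show ?thesis
  proof (rule that[of Y])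
    show "Y \<in> borel_measurable M" using tower(1) by (simp add: Y_def[abs_def])
    show "\<exists>A\<in>sets M. 0 < prob A \<and>
       (AE \<omega> in M. \<omega> \<in> A \<longrightarrow> 2 ^ n * prob A powr (1 / q - 1) \<le> Y \<omega>)" for n
      using tower(2)[of n] pos[of n] by (intro bexI[of _ "A n"]) (auto simp: Y_def c_def)
    have step: "ennreal (c n) * (\<integral>\<^sup>+u\<in>{1 - prob (A n)<..<1}. ennreal (s u) \<partial>lborel)
        \<le> ennreal ((1 / 2) ^ n)" for n
    proof -
      have "ennreal (c n) * (\<integral>\<^sup>+u\<in>{1 - prob (A n)<..<1}. ennreal (s u) \<partial>lborel)
          \<le> ennreal (c n) * ennreal ((1 / 4) ^ n * prob (A n) powr (1 - 1 / q))"
        using Q[of n] by (intro mult_left_mono) (auto simp: Q_def)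
      also have "\<dots> = ennreal (c n * ((1 / 4) ^ n * prob (A n) powr (1 - 1 / q)))"
        using c by (simp add: ennreal_mult)
      also have "c n * ((1 / 4) ^ n * prob (A n) powr (1 - 1 / q))
          = (2 * (1 / 4)) ^ n * (prob (A n) powr (1 / q - 1) * prob (A n) powr (1 - 1 / q))"
        unfolding c_def power_mult_distrib by (simp only: ac_simps)
      also have "\<dots> = (1 / 2) ^ n"
        using pos[of n] by (simp flip: powr_add)
      finally show ?thesis .
    qed
    have "(\<integral>\<^sup>+u\<in>{0<..<1}. ennreal (s u * quantile M (\<lambda>\<omega>. \<bar>Y \<omega>\<bar>) u) \<partial>lborel)
        \<le> (\<integral>\<^sup>+u. (\<Sum>n. ennreal (c n) * (ennreal (s u) * indicator {1 - prob (A n)<..<1} u)) \<partial>lborel)"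
    proof (intro nn_integral_mono)
      fix u :: real
      have "ennreal (s u) * ennreal (quantile M (\<lambda>\<omega>. \<bar>Y \<omega>\<bar>) u)
          \<le> ennreal (s u) * (\<Sum>n. ennreal (c n) * indicator {1 - prob (A n)<..<1} u)" if "0 < u" "u < 1"
        using tower(3)[OF that] by (intro mult_left_mono) (auto simp: Y_def)
      then show "ennreal (s u * quantile M (\<lambda>\<omega>. \<bar>Y \<omega>\<bar>) u) * indicator {0<..<1} u
          \<le> (\<Sum>n. ennreal (c n) * (ennreal (s u) * indicator {1 - prob (A n)<..<1} u))"
        using s by (auto simp: indicator_def[of "{0<..<1}"] ennreal_mult' mult.left_commute[of "ennreal (c _)"])
    qed
    also have "\<dots> = (\<Sum>n. ennreal (c n) * (\<integral>\<^sup>+u\<in>{1 - prob (A n)<..<1}. ennreal (s u) \<partial>lborel))"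
      by (simp add: nn_integral_suminf nn_integral_cmult)
    also have "\<dots> \<le> (\<Sum>n. ennreal ((1 / 2) ^ n))"
      by (intro suminf_le step) auto
    also have "\<dots> = ennreal (\<Sum>n. (1 / 2) ^ n)"
      by (intro suminf_ennreal2) (auto intro: summable_geometric)
    finally show "(\<integral>\<^sup>+u\<in>{0<..<1}. ennreal (s u * quantile M (\<lambda>\<omega>. \<bar>Y \<omega>\<bar>) u) \<partial>lborel) < \<infinity>"
      by (simp add: le_less_trans)
  qed
qed

section \<open>Comparison with the Lebesgue spaces\<close>

text \<open>Division on extended reals has \<open>1 / 0 = \<infinity>\<close> and \<open>1 / \<infinity> = 0\<close>, so the conjugacy equation excludes
  \<open>p = 0\<close> and pairs \<open>p = \<infinity>\<close> with \<open>q = 1\<close> only.\<close>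

lemma conjugate_exponent_cases:
  fixes p :: ennreal
  assumes "1 \<le> q" "1 / p + 1 / ennreal q = 1"
  obtains "q = 1" "p = \<infinity>"
  | r where "1 < q" "p = ennreal r" "1 < r" "1 / r + 1 / q = 1"
proof (cases p)
  case top
  with assms have "q = 1" by (simp add: divide_ennreal flip: ennreal_1)
  with top that(1) show ?thesis by simp
next
  case (real r)
  have "r \<noteq> 0" using assms real by (auto simp: divide_ennreal_def)
  with real have "0 < r" by simp
  have "ennreal (1 / r + 1 / q) = 1"
    using assms(2) \<open>0 < r\<close> \<open>1 \<le> q\<close> real
    by (simp add: divide_ennreal ennreal_plus[symmetric] del: ennreal_plus flip: ennreal_1)
  then have e: "1 / r + 1 / q = 1" by (simp only: ennreal_eq_1)
  then have "q \<noteq> 1" using \<open>0 < r\<close> by auto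
  with \<open>1 \<le> q\<close> have "1 < q" by simp
  then have "0 < 1 / q" by simp
  then have "1 / r < 1" using e by linarith
  then have "1 < r" using \<open>0 < r\<close> by simp
  with \<open>1 < q\<close> e real that(2) show ?thesis by blast
qed

text \<open>For \<open>p = \<infinity>\<close> the peaks are unbounded on events of positive probability. For finite \<open>p\<close>, a peak
  contributes at least \<open>(2 ^ n) powr p\<close> to the \<open>p\<close>-th moment: the \<open>p\<close>-th power of
  \<open>prob A powr (1 / q - 1)\<close> is \<open>1 / prob A\<close>.\<close>

lemma (in prob_space) not_in_Lp_of_large_peaks:
  fixes Y :: "'a \<Rightarrow> real"
  assumes q: "1 \<le> q" and p: "1 / p + 1 / ennreal q = 1"
    and peaks: "\<And>n. \<exists>A\<in>sets M. 0 < prob A \<and>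
       (AE \<omega> in M. \<omega> \<in> A \<longrightarrow> 2 ^ n * prob A powr (1 / q - 1) \<le> Y \<omega>)"
  shows "Y \<notin> Lp_fun M p"
  using q p
proof (cases rule: conjugate_exponent_cases)
  case 1
  show ?thesis
  proof
    assume "Y \<in> Lp_fun M p"
    then obtain C where C: "AE \<omega> in M. \<bar>Y \<omega>\<bar> \<le> C" using 1 by (auto simp: Lp_fun_def)
    obtain n where n: "C < 2 ^ n" using real_arch_pow[of 2 C] by auto
    obtain A where A: "A \<in> sets M" "0 < prob A" "AE \<omega> in M. \<omega> \<in> A \<longrightarrow> 2 ^ n \<le> Y \<omega>"
      using peaks[of n] 1 by auto
    from A(3) C have "AE \<omega> in M. \<omega> \<notin> A" by eventually_elim (use n in auto)
    with A(1,2) show False by (simp add: prob_eq_0[symmetric])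
  qed
next
  case (2 r)
  show ?thesis
  proof
    assume "Y \<in> Lp_fun M p"
    then have Y[measurable]: "Y \<in> borel_measurable M"
      and int: "integrable M (\<lambda>\<omega>. \<bar>Y \<omega>\<bar> powr r)"
      using 2 by (auto simp: Lp_fun_def)
    have "2 ^ n \<le> expectation (\<lambda>\<omega>. \<bar>Y \<omega>\<bar> powr r)" for n
    proof -
      obtain A where A[measurable]: "A \<in> sets M" and pos: "0 < prob A"
        and ge: "AE \<omega> in M. \<omega> \<in> A \<longrightarrow> 2 ^ n * prob A powr (1 / q - 1) \<le> Y \<omega>"
        using peaks by blast
      have e: "(1 / q - 1) * r = - 1" using 2 by (simp add: field_simps)
      have "(2::real) ^ n \<le> (2 ^ n) powr r"
        using 2 powr_mono[of 1 r "2 ^ n :: real"] by simp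
      also have "\<dots> = (2 ^ n * prob A powr (1 / q - 1)) powr r * prob A"
        using pos by (simp add: powr_mult powr_powr e powr_minus)
      also have "\<dots> = expectation (\<lambda>\<omega>. (2 ^ n * prob A powr (1 / q - 1)) powr r * indicator A \<omega>)"
        by (subst integral_mult_right_zero) simp
      also have "\<dots> \<le> expectation (\<lambda>\<omega>. \<bar>Y \<omega>\<bar> powr r)"
      proof (intro integral_mono_AE int)
        show "integrable M (\<lambda>\<omega>. (2 ^ n * prob A powr (1 / q - 1)) powr r * indicator A \<omega>)"
          by (intro integrable_mult_right integrable_real_indicator) (auto simp: emeasure_eq_measure)
        show "AE \<omega> in M. (2 ^ n * prob A powr (1 / q - 1)) powr r * indicator A \<omega> \<le> \<bar>Y \<omega>\<bar> powr r"
          using ge 2 by (auto elim!: eventually_mono simp: indicator_def intro!: powr_mono2)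
      qed
      finally show ?thesis .
    qed
    moreover obtain n where "expectation (\<lambda>\<omega>. \<bar>Y \<omega>\<bar> powr r) < 2 ^ n"
      using real_arch_pow[of 2] by auto
    ultimately show False using not_le by blast
  qed
qed

lemma (in prob_space) Lp_finite_quantile_integral:
  fixes s :: "real \<Rightarrow> real"
  assumes [measurable]: "s \<in> borel_measurable borel" and s: "\<And>u. 0 \<le> s u" and q: "1 \<le> q"
    and fin: "(\<integral>\<^sup>+u. ennreal (s u powr q) \<partial>lborel) < \<infinity>"
    and p: "1 / p + 1 / ennreal q = 1" and Y: "Y \<in> Lp_fun M p"
  shows "(\<integral>\<^sup>+u\<in>{0<..<1}. ennreal (s u * quantile M (\<lambda>\<omega>. \<bar>Y \<omega>\<bar>) u) \<partial>lborel) < \<infinity>"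
proof -
  have [measurable]: "Y \<in> borel_measurable M" using Y by (auto simp: Lp_fun_def split: if_splits)
  define G where "G = quantile M (\<lambda>\<omega>. \<bar>Y \<omega>\<bar>)"
  have G: "0 \<le> G u" if "0 < u" "u < 1" for u
    unfolding G_def using that by (intro quantile_nonneg) auto
  show ?thesis
    unfolding G_def[symmetric] using q p
  proof (cases rule: conjugate_exponent_cases)
    case 1
    then obtain C where C: "AE \<omega> in M. \<bar>Y \<omega>\<bar> \<le> C" using Y by (auto simp: Lp_fun_def)
    then have "\<P>(\<omega> in M. \<bar>Y \<omega>\<bar> \<le> C) = 1" by (subst prob_Collect_eq_1) auto
    then have le: "G u \<le> C" if "0 < u" "u < 1" for u
      unfolding G_def using that by (subst quantile_le_iff) auto
    then have "0 \<le> C" using G[of "1/2"] le[of "1/2"] by linarith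
    have "(\<integral>\<^sup>+u\<in>{0<..<1}. ennreal (s u * G u) \<partial>lborel)
        \<le> (\<integral>\<^sup>+u. ennreal C * ennreal (s u powr q) \<partial>lborel)"
      using le s 1 \<open>0 \<le> C\<close>
      by (intro nn_integral_mono)
        (auto simp: indicator_def mult.commute[of C] ennreal_mult[symmetric] intro!: ennreal_leI mult_left_mono)
    also have "\<dots> < \<infinity>"
      using fin by (simp add: nn_integral_cmult ennreal_mult_less_top)
    finally show "(\<integral>\<^sup>+u\<in>{0<..<1}. ennreal (s u * G u) \<partial>lborel) < \<infinity>" .
  next
    case (2 r)
    have young: "s u * G u \<le> s u powr q + G u powr r" if "0 < u" "u < 1" for u
    proof -
      have "s u * G u \<le> s u powr q / q + G u powr r / r"
        using 2 s G[OF that] by (intro Youngs_inequality) auto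
      also have "\<dots> \<le> s u powr q + G u powr r"
        using 2 by (intro add_mono) (auto simp: divide_le_eq mult_le_cancel_left1)
      finally show ?thesis .
    qed
    (* Quantiles are measurable on (0,1) only; the extension by 0 is measurable on the whole line. *)
    define h where "h u = (if u \<in> {0<..<1} then G u else 0)" for u
    have "h \<in> borel_measurable lborel"
      unfolding h_def[abs_def] G_def
      using quantile_measurable[of "\<lambda>\<omega>. \<bar>Y \<omega>\<bar>"]
      by (subst measurable_restrict_space_iff[symmetric]) auto
    then have [measurable]: "h \<in> borel_measurable borel" by simp
    have "(\<integral>\<^sup>+u\<in>{0<..<1}. ennreal (s u * G u) \<partial>lborel)
        \<le> (\<integral>\<^sup>+u. ennreal (s u powr q) + ennreal (h u powr r) \<partial>lborel)"
      using young by (intro nn_integral_mono)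
        (auto simp: h_def indicator_def ennreal_plus[symmetric] simp del: ennreal_plus intro!: ennreal_leI)
    also have "\<dots> = (\<integral>\<^sup>+u. ennreal (s u powr q) \<partial>lborel) + (\<integral>\<^sup>+u. ennreal (h u powr r) \<partial>lborel)"
      by (intro nn_integral_add) auto
    also have "(\<integral>\<^sup>+u. ennreal (h u powr r) \<partial>lborel) = (\<integral>\<^sup>+u\<in>{0<..<1}. ennreal (G u powr r) \<partial>lborel)"
      by (intro nn_integral_cong) (auto simp: h_def indicator_def)
    also have "\<dots> = (\<integral>\<^sup>+\<omega>. ennreal (\<bar>Y \<omega>\<bar> powr r) \<partial>M)"
      unfolding G_def by (rule nn_integral_quantile) auto
    also have "(\<integral>\<^sup>+u. ennreal (s u powr q) \<partial>lborel) + \<dots> < \<infinity>"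
      using fin Y 2 by (auto simp: Lp_fun_def integrable_iff_bounded)
    finally show "(\<integral>\<^sup>+u\<in>{0<..<1}. ennreal (s u * G u) \<partial>lborel) < \<infinity>" .
  qed
qed

text \<open>Saturation of the smaller set is essential: without it an element of \<open>B - A\<close> may be equivalent
  to one of \<open>A\<close>.\<close>

lemma quotient_psubset_quotient:
  assumes "equiv U R" "A \<subseteq> B" "B \<subseteq> U" and sat: "\<And>x y. (x, y) \<in> R \<Longrightarrow> x \<in> A \<Longrightarrow> y \<in> A"
    and y: "y \<in> B" "y \<notin> A"
  shows "A // R \<subset> B // R"
proof -
  have "R `` {y} \<notin> A // R"
  proof
    assume "R `` {y} \<in> A // R"
    then obtain x where "x \<in> A" "R `` {x} = R `` {y}" by (auto elim: quotientE)
    with \<open>equiv U R\<close> y \<open>B \<subseteq> U\<close> have "(x, y) \<in> R"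
      by (metis Image_singleton_iff equiv_class_self subsetD)
    with sat \<open>x \<in> A\<close> y show False by blast
  qed
  moreover have "R `` {y} \<in> B // R" using y(1) by (rule quotientI)
  moreover have "A // R \<subseteq> B // R" using \<open>A \<subseteq> B\<close> by (auto simp: quotient_def)
  ultimately show ?thesis by blast
qed

lemma (in prob_space) Lp_psubset_L_spectral:
  fixes q :: real
  assumes "atomless M" and \<sigma>: "spectral_function \<sigma>"
    and q: "1 \<le> q" and p: "1 / p + 1 / ennreal q = 1"
    and \<sigma>q: "\<sigma> \<in> Lp_fun (restrict_space lborel {0..<1}) (ennreal q)"
  shows "Lp M p \<subset> L_spectral M \<sigma>"
proof -
  (* The values of \<sigma> outside [0,1) are arbitrary, so \<sigma> itself need not be measurable or nonnegative. *)
  define s where "s u = indicator {0..<1} u * \<sigma> u" for u :: real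
  have meas: "s \<in> borel_measurable borel"
    using \<sigma> by (auto simp: spectral_function_def set_integrable_def s_def[abs_def] dest: borel_measurable_integrable)
  have nonneg: "0 \<le> s u" for u
    using \<sigma> by (auto simp: spectral_function_def s_def indicator_def)
  have "integrable lborel (\<lambda>u. indicator {0..<1} u *\<^sub>R \<bar>\<sigma> u\<bar> powr q)"
    using \<sigma>q q by (simp add: Lp_fun_def integrable_restrict_space)
  then have "integrable lborel (\<lambda>u. s u powr q)"
    by (rule Bochner_Integration.integrable_cong[THEN iffD1, rotated 2])
      (use \<sigma> in \<open>auto simp: s_def indicator_def spectral_function_def\<close>)
  then have fin: "(\<integral>\<^sup>+u. ennreal (s u powr q) \<partial>lborel) < \<infinity>"
    by (simp add: integrable_iff_bounded)
  have mem: "Y \<in> L_spectral_fun M \<sigma> \<longleftrightarrow> Y \<in> borel_measurable M \<and>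
      (\<integral>\<^sup>+u\<in>{0<..<1}. ennreal (s u * quantile M (\<lambda>\<omega>. \<bar>Y \<omega>\<bar>) u) \<partial>lborel) < \<infinity>" for Y
  proof -
    have "(\<integral>\<^sup>+u\<in>{0<..<1}. ennreal (s u * quantile M (\<lambda>\<omega>. \<bar>Y \<omega>\<bar>) u) \<partial>lborel) =
        (\<integral>\<^sup>+u\<in>{0<..<1}. ennreal (\<sigma> u * quantile M (\<lambda>\<omega>. \<bar>Y \<omega>\<bar>) u) \<partial>lborel)"
      by (intro nn_integral_cong) (auto simp: s_def indicator_def)
    moreover have "enn2ereal x < \<infinity> \<longleftrightarrow> x < \<infinity>" for x
      by (simp flip: less_top)
    ultimately show ?thesis
      using spectral_norm_eq_nn_integral[OF \<sigma>, of Y] unfolding L_spectral_fun_def by (metis (lifting) mem_Collect_eq)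
  qed
  obtain Y where Y: "Y \<in> borel_measurable M"
    "(\<integral>\<^sup>+u\<in>{0<..<1}. ennreal (s u * quantile M (\<lambda>\<omega>. \<bar>Y \<omega>\<bar>) u) \<partial>lborel) < \<infinity>"
    "\<And>n. \<exists>A\<in>sets M. 0 < prob A \<and>
       (AE \<omega> in M. \<omega> \<in> A \<longrightarrow> 2 ^ n * prob A powr (1 / q - 1) \<le> Y \<omega>)"
    using exists_finite_norm_large_peaks[OF \<open>atomless M\<close> meas nonneg q fin] by blast
  show ?thesis
    unfolding Lp_def L_spectral_def
  proof (rule quotient_psubset_quotient[OF equiv_ae_eq])
    show "Lp_fun M p \<subseteq> L_spectral_fun M \<sigma>"
      using Lp_finite_quantile_integral[OF meas nonneg q fin p]
      by (auto simp: mem) (auto simp: Lp_fun_def split: if_splits)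
    show "L_spectral_fun M \<sigma> \<subseteq> borel_measurable M" by (auto simp: L_spectral_fun_def)
    show "Y \<in> L_spectral_fun M \<sigma>" using Y by (simp add: mem)
    show "Y \<notin> Lp_fun M p" using q p Y(3) by (rule not_in_Lp_of_large_peaks)
  qed (simp add: Lp_fun_ae_eq)
qed

theorem theorem16:
  fixes M :: "'a measure" and \<sigma> :: "real \<Rightarrow> real"
  assumes "prob_space M" and "atomless M" and "spectral_function \<sigma>"
  shows "(\<forall>(q::real) (p::ennreal). 1 \<le> q \<longrightarrow> 1 / p + 1 / ennreal q = 1 \<longrightarrow>
            \<sigma> \<in> Lp_fun (restrict_space lborel {0..<1}) (ennreal q) \<longrightarrow>
            Lp M p \<subset> L_spectral M \<sigma>)
         \<and> Lp M \<infinity> \<subset> L_spectral M \<sigma>"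
proof -
  interpret prob_space M by fact
  have int: "integrable (restrict_space lborel {0..<1}) \<sigma>"
    using assms(3) by (simp add: spectral_function_def set_integrable_def integrable_restrict_space)
  then have "\<sigma> \<in> Lp_fun (restrict_space lborel {0..<1}) (ennreal 1)"
    by (auto simp: Lp_fun_def)
  then have "Lp M \<infinity> \<subset> L_spectral M \<sigma>"
    using assms(2,3) by (intro Lp_psubset_L_spectral[of _ 1]) auto
  with assms(2,3) Lp_psubset_L_spectral show ?thesis by blast
qed

end
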